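(* Fix $C_\tau>0$. There exist constants $0<c\le C<\infty$, depending on $C_\tau$ but independent of $\boldsymbol h$, $\boldsymbol n$, $\tau$ and $d$, such that for every bias configuration $\boldsymbol h\in[0,1]^m$, every vector of sample sizes $\boldsymbol n=(n_0,\dots,n_m)\in\mathbb N^{m+1}$ and every $\tau>0$ with $d\tau^2/n_0\le 1$, $$c\cdot \mathfrak R(\boldsymbol h,\boldsymbol n,\tau)\;\le\;\inf_{\widehat\theta_{0,\boldsymbol h}}\ \sup_{P\in\mathcal P(\boldsymbol h,\boldsymbol n,\tau)}\ \mathbb E_P\big[\|\widehat\theta_{0,\boldsymbol h}-\theta_0^\star\|_2^2\big]\;\le\; C\cdot\mathfrak R(\boldsymbol h,\boldsymbol n,\tau),$$ where the infimum is over all estimators $\widehat\theta_{0,\boldsymbol h}$, i.e. functions of $(\widetilde\theta_0,\dots,\widetilde\theta_m)$ that may depend on $\boldsymbol h,\boldsymbol n,\tau$, and $$\mathfrak R(\boldsymbol h,\boldsymbol n,\tau):=\min_{\{0\}\subset S\subset\{0,\dots,m\}}\Big\{\frac{d\tau^2}{N_S}+h_S^2\Big\},\qquad h_0:=0,\quad h_S:=\max_{k\in S}h_k,\quad N_S:=\sum_{k\in S}n_k .$$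
   Context: There are $m+1$ domains ($k=0$ is the target, $k=1,\dots,m$ are sources), with parameters $\theta_0^\star,\dots,\theta_m^\star\in\mathbb R^d$, sample sizes $n_k\ge 1$, and local estimators $\widetilde\theta_0,\dots,\widetilde\theta_m$, random vectors in $\mathbb R^d$. For $\boldsymbol h=(h_1,\dots,h_m)\in[0,1]^m$ let $\Theta(\boldsymbol h)=\{(\theta_0^\star,\dots,\theta_m^\star):\|\theta_k^\star-\theta_0^\star\|_2\le h_k,\ k=1,\dots,m\}$. The class $\mathcal P(\boldsymbol h,\boldsymbol n,\tau)$ (the constant $C_\tau$ is suppressed in the notation) is the set of joint distributions of $(\widetilde\theta_0,\dots,\widetilde\theta_m)$ such that the $\widetilde\theta_k$ are independent and there is $(\theta_0^\star,\dots,\theta_m^\star)\in\Theta(\boldsymbol h)$ with $$\max_{\|a\|_2=1}P\big(a^\top(\widetilde\theta_k-\theta_k^\star)>t\big)\le C_\tau\exp\Big(-\frac{n_kt^2}{2\tau^2}\Big)\quad\text{for all }t>0,\ k=0,\dots,m .$$ Set inclusions $\{0\}\subset S$ are non-strict. *)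

theory Defs
  imports "HOL-Probability.Probability"
begin

text \<open>
  The constants of the result must not depend on the dimension \<open>d\<close>, so \<open>d\<close> is quantified inside the
  statement and cannot be a type.  Vectors of \<open>\<real>\<^sup>d\<close> are functions \<open>nat \<Rightarrow> real\<close> on the index set
  \<open>{..<d}\<close>; the Borel space \<open>\<real>\<^sup>d\<close> is the corresponding product space, and the Euclidean norm
  is \<open>L2_set\<close> over \<open>{..<d}\<close>.  Domains are numbered by \<open>{..m}\<close>, with \<open>0\<close> the target.
\<close>

definition eucl_space :: "nat \<Rightarrow> (nat \<Rightarrow> real) measure" where
  "eucl_space d = (\<Pi>\<^sub>M i\<in>{..<d}. (borel :: real measure))"

definition joint_space :: "nat \<Rightarrow> nat \<Rightarrow> (nat \<Rightarrow> nat \<Rightarrow> real) measure" where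
  "joint_space m d = (\<Pi>\<^sub>M k\<in>{..m}. eucl_space d)"

definition eucl_dist :: "nat \<Rightarrow> (nat \<Rightarrow> real) \<Rightarrow> (nat \<Rightarrow> real) \<Rightarrow> real" where
  "eucl_dist d x y = L2_set (\<lambda>i. x i - y i) {..<d}"

definition param_class :: "nat \<Rightarrow> nat \<Rightarrow> (nat \<Rightarrow> real) \<Rightarrow> (nat \<Rightarrow> nat \<Rightarrow> real) set" where
  "param_class m d h =
     {\<theta> \<in> space (joint_space m d). \<forall>k\<in>{1..m}. eucl_dist d (\<theta> k) (\<theta> 0) \<le> h k}"

text \<open>
  The maximum over unit vectors need not be attained for a general distribution; it is read as a
  supremum (over a nonempty set when \<open>d \<ge> 1\<close>, and of values bounded by \<open>1\<close>).
\<close>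

definition tail_bound ::
  "nat \<Rightarrow> nat \<Rightarrow> real \<Rightarrow> (nat \<Rightarrow> nat) \<Rightarrow> real \<Rightarrow> (nat \<Rightarrow> nat \<Rightarrow> real) measure
     \<Rightarrow> (nat \<Rightarrow> nat \<Rightarrow> real) \<Rightarrow> bool" where
  "tail_bound m d C\<^sub>\<tau> n \<tau> P \<theta> \<longleftrightarrow>
     (\<forall>k\<in>{..m}. \<forall>t>0.
        (SUP a\<in>{a. L2_set a {..<d} = 1}.
           measure P {x \<in> space P. (\<Sum>i<d. a i * (x k i - \<theta> k i)) > t})
        \<le> C\<^sub>\<tau> * exp (- (real (n k) * t\<^sup>2 / (2 * \<tau>\<^sup>2))))"

text \<open>The parameter configurations in the class that a joint distribution is compatible with.\<close>

definition true_params ::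
  "nat \<Rightarrow> nat \<Rightarrow> real \<Rightarrow> (nat \<Rightarrow> real) \<Rightarrow> (nat \<Rightarrow> nat) \<Rightarrow> real
     \<Rightarrow> (nat \<Rightarrow> nat \<Rightarrow> real) measure \<Rightarrow> (nat \<Rightarrow> nat \<Rightarrow> real) set" where
  "true_params m d C\<^sub>\<tau> h n \<tau> P = {\<theta> \<in> param_class m d h. tail_bound m d C\<^sub>\<tau> n \<tau> P \<theta>}"

definition dist_class ::
  "nat \<Rightarrow> nat \<Rightarrow> real \<Rightarrow> (nat \<Rightarrow> real) \<Rightarrow> (nat \<Rightarrow> nat) \<Rightarrow> real
     \<Rightarrow> (nat \<Rightarrow> nat \<Rightarrow> real) measure set" where
  "dist_class m d C\<^sub>\<tau> h n \<tau> =
     {P. prob_space P \<and> sets P = sets (joint_space m d) \<and>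
         prob_space.indep_vars P (\<lambda>_. eucl_space d) (\<lambda>k x. x k) {..m} \<and>
         (\<exists>\<theta>. \<theta> \<in> true_params m d C\<^sub>\<tau> h n \<tau> P)}"

text \<open>
  A distribution in the class does not determine its parameters, so the worst case is taken over
  all pairs of a distribution and a compatible parameter configuration.  Risks may be infinite and
  are therefore \<open>ennreal\<close>-valued; estimators are Borel functions of the local estimators, and since
  the infimum is taken for fixed \<open>h\<close>, \<open>n\<close>, \<open>\<tau>\<close> they may depend on these.
\<close>

definition worst_risk ::
  "nat \<Rightarrow> nat \<Rightarrow> real \<Rightarrow> (nat \<Rightarrow> real) \<Rightarrow> (nat \<Rightarrow> nat) \<Rightarrow> real
     \<Rightarrow> ((nat \<Rightarrow> nat \<Rightarrow> real) \<Rightarrow> nat \<Rightarrow> real) \<Rightarrow> ennreal" where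
  "worst_risk m d C\<^sub>\<tau> h n \<tau> est =
     (SUP P\<in>dist_class m d C\<^sub>\<tau> h n \<tau>. SUP \<theta>\<in>true_params m d C\<^sub>\<tau> h n \<tau> P.
        \<integral>\<^sup>+ x. ennreal ((eucl_dist d (est x) (\<theta> 0))\<^sup>2) \<partial>P)"

definition minimax_risk ::
  "nat \<Rightarrow> nat \<Rightarrow> real \<Rightarrow> (nat \<Rightarrow> real) \<Rightarrow> (nat \<Rightarrow> nat) \<Rightarrow> real \<Rightarrow> ennreal" where
  "minimax_risk m d C\<^sub>\<tau> h n \<tau> =
     (INF est\<in>measurable (joint_space m d) (eucl_space d). worst_risk m d C\<^sub>\<tau> h n \<tau> est)"

text \<open>The update \<open>h(0 := 0)\<close> is the convention \<open>h\<^sub>0 = 0\<close>; \<open>h 0\<close> itself is never used.\<close>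

definition rate :: "nat \<Rightarrow> nat \<Rightarrow> (nat \<Rightarrow> real) \<Rightarrow> (nat \<Rightarrow> nat) \<Rightarrow> real \<Rightarrow> real" where
  "rate m d h n \<tau> =
     (MIN S\<in>{S. {0} \<subseteq> S \<and> S \<subseteq> {..m}}.
        real d * \<tau>\<^sup>2 / real (\<Sum>k\<in>S. n k) + (MAX k\<in>S. (h(0 := 0)) k)\<^sup>2)"

end

theory Submission imports Defs "HOL-Real_Asymp.Real_Asymp" begin

text \<open>
  The number of sources is fixed before the constants are chosen, so the constants may depend on \<open>m\<close>,
  and pooling \<open>m + 1\<close> samples is then no better, up to a constant, than using the largest of them.

  For the upper bound (\<open>minimax_risk_le_rate\<close>), let \<open>S\<close> attain the minimum in the rate and report the
  local estimator in \<open>S\<close> with the largest sample.  Its squared bias is at most \<open>h\<^sub>S\<^sup>2\<close>.  The tail condition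
  in the coordinate directions bounds the second moment of each coordinate error by a constant
  times \<open>\<tau>\<^sup>2 / n\<^sub>k\<close> (\<open>second_moment_le_of_subgaussian_tail\<close>), and \<open>N\<^sub>S \<le> (m + 1) n\<^sub>k\<close>.

  For the lower bound (\<open>rate_le_minimax_risk\<close>), write \<open>R\<close> for the rate and let \<open>S\<close> be the set of domains
  with \<open>h\<^sub>k\<^sup>2 \<le> R / 2\<close>.  The other sources have parameter \<open>0\<close> and report it exactly.  The domains in \<open>S\<close> share
  the parameter \<open>v = \<delta> \<epsilon>\<close> with an unknown sign vector \<open>\<epsilon>\<close> and \<open>d \<delta>\<^sup>2 = R / 8\<close>; their estimators have
  independent coordinates, equal to \<open>2 v\<^sub>i\<close> with probability \<open>3/4\<close> and to \<open>- 2 v\<^sub>i\<close> otherwise.  These are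
  unbiased and bounded, so by Hoeffding's inequality they satisfy the tail condition in every
  direction with a constant that does not depend on \<open>d\<close> (\<open>noisy_vec_tail\<close>).  On the other hand, each of
  the at most \<open>m + 1\<close> informative estimators distinguishes two values of the sign \<open>\<epsilon>\<^sub>i\<close> only by a
  likelihood ratio of \<open>3\<close>, so every estimator errs by a constant multiple of \<open>\<delta>\<^sup>2\<close> in each coordinate on
  average over \<open>\<epsilon>\<close> (\<open>two_hypotheses_error\<close>, \<open>hypercube_average\<close>).  To allow constants \<open>C\<^sub>\<tau> < 1\<close>, every
  local estimator in \<open>S\<close> is noisy only with probability \<open>p = min 1 C\<^sub>\<tau>\<close> and exact otherwise.
\<close>

section \<open>Second moments from sub-Gaussian tails\<close>

definition odd_gauss_sum :: real where
  "odd_gauss_sum = (\<Sum>j. (2 * real j + 1) * exp (- ((real j)\<^sup>2 / 2)))"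

lemma summable_odd_gauss: "summable (\<lambda>j. (2 * real j + 1) * exp (- ((real j)\<^sup>2 / 2)))"
proof (rule summable_comparison_test_bigo)
  show "summable (\<lambda>j. norm (1 / real j ^ 2))"
    using inverse_power_summable[of 2, where ?'a = real] by (simp add: field_simps)
  show "(\<lambda>j. (2 * real j + 1) * exp (- ((real j)\<^sup>2 / 2))) \<in> O(\<lambda>j. 1 / real j ^ 2)"
    by real_asymp
qed

lemma odd_gauss_sum_nonneg: "0 \<le> odd_gauss_sum"
  unfolding odd_gauss_sum_def by (intro suminf_nonneg summable_odd_gauss) auto

lemma sum_odd_eq_square: "(\<Sum>j<J. 2 * real j + 1) = (real J)\<^sup>2"
  by (induction J) (auto simp: power2_eq_square algebra_simps)

text \<open>
  A discrete layer-cake formula: if \<open>J\<close> levels \<open>0, s, \<dots>, (J - 1) s\<close> lie below \<open>y\<close>, then \<open>y \<le> J s\<close>, and the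
  first \<open>J\<close> odd numbers add up to \<open>J\<^sup>2\<close>.  Summing over levels turns a tail bound into a moment bound.
\<close>

lemma square_le_level_sum:
  fixes y s :: real
  assumes "s > 0" "y \<ge> 0"
  shows "ennreal (y\<^sup>2) \<le>
    ennreal (s\<^sup>2) * (\<Sum>j. ennreal (2 * real j + 1) * indicator {real j * s <..} y)"
proof -
  define J where "J = nat \<lceil>y / s\<rceil>"
  have J: "y \<le> real J * s"
  proof -
    have "y / s \<le> real J" unfolding J_def by (rule of_nat_ceiling)
    thus ?thesis using assms by (simp add: field_simps)
  qed
  have lvl: "real j * s < y" if "j < J" for j
  proof -
    have "int j < \<lceil>y / s\<rceil>" using that unfolding J_def by linarith
    hence "real j < y / s" by linarith
    thus ?thesis using assms by (simp add: field_simps)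
  qed
  have "y\<^sup>2 \<le> (real J * s)\<^sup>2" using J assms by (intro power_mono) auto
  also have "\<dots> = s\<^sup>2 * (\<Sum>j<J. 2 * real j + 1)"
    unfolding sum_odd_eq_square by (simp add: power_mult_distrib)
  finally have "ennreal (y\<^sup>2) \<le> ennreal (s\<^sup>2 * (\<Sum>j<J. 2 * real j + 1))"
    by (rule ennreal_leI)
  also have "\<dots> = ennreal (s\<^sup>2) * (\<Sum>j<J. ennreal (2 * real j + 1))"
    by (subst ennreal_mult) (auto intro!: sum_nonneg simp del: ennreal_plus)
  also have "(\<Sum>j<J. ennreal (2 * real j + 1)) =
      (\<Sum>j<J. ennreal (2 * real j + 1) * indicator {real j * s <..} y)"
    by (intro sum.cong) (use lvl in auto)
  also have "\<dots> \<le> (\<Sum>j. ennreal (2 * real j + 1) * indicator {real j * s <..} y)"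
    by (rule sum_le_suminf) auto
  finally show ?thesis by (simp add: mult_left_mono)
qed

text \<open>
  Integrating the level sums termwise leaves the tail probabilities at the levels \<open>j s\<close>.  The tail
  bound covers the levels \<open>j \<ge> 1\<close>; at \<open>j = 0\<close> the probability is bounded by \<open>1\<close>, which is why \<open>A \<ge> 1\<close>
  is required.
\<close>

lemma (in prob_space) second_moment_le_of_subgaussian_tail:
  fixes Y :: "'a \<Rightarrow> real" and s A :: real
  assumes [measurable]: "Y \<in> borel_measurable M" and "s > 0" "A \<ge> 1"
    and tail: "\<And>t. t > 0 \<Longrightarrow> prob {x \<in> space M. \<bar>Y x\<bar> > t} \<le> A * exp (- (t\<^sup>2 / (2 * s\<^sup>2)))"
  shows "(\<integral>\<^sup>+x. ennreal ((Y x)\<^sup>2) \<partial>M) \<le> ennreal (A * odd_gauss_sum * s\<^sup>2)"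
proof -
  let ?I = "\<lambda>j x. indicator {real j * s <..} \<bar>Y x\<bar> :: ennreal"
  have level: "(\<integral>\<^sup>+x. ?I j x \<partial>M) \<le> ennreal (A * exp (- ((real j)\<^sup>2 / 2)))" for j
  proof -
    have "(\<integral>\<^sup>+x. ?I j x \<partial>M) =
        (\<integral>\<^sup>+x. indicator {x \<in> space M. \<bar>Y x\<bar> > real j * s} x \<partial>M)"
      by (intro nn_integral_cong) (auto split: split_indicator)
    also have "\<dots> = ennreal (prob {x \<in> space M. \<bar>Y x\<bar> > real j * s})"
      by (subst nn_integral_indicator) (auto simp: emeasure_eq_measure)
    also have "\<dots> \<le> ennreal (A * exp (- ((real j)\<^sup>2 / 2)))"
    \<comment> \<open>The hypothesis says nothing about the level zero.\<close>
    proof (intro ennreal_leI, cases "j = 0")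
      case True
      then show "prob {x \<in> space M. \<bar>Y x\<bar> > real j * s} \<le> A * exp (- ((real j)\<^sup>2 / 2))"
        using \<open>A \<ge> 1\<close> order_trans[OF prob_le_1] by auto
    next
      case False
      with tail[of "real j * s"] \<open>s > 0\<close>
      show "prob {x \<in> space M. \<bar>Y x\<bar> > real j * s} \<le> A * exp (- ((real j)\<^sup>2 / 2))"
        by (simp add: power_mult_distrib)
    qed
    finally show ?thesis .
  qed
  have "(\<integral>\<^sup>+x. ennreal ((Y x)\<^sup>2) \<partial>M) \<le>
      (\<integral>\<^sup>+x. ennreal (s\<^sup>2) * (\<Sum>j. ennreal (2 * real j + 1) * ?I j x) \<partial>M)"
    by (intro nn_integral_mono) (use square_le_level_sum[OF \<open>s > 0\<close>, of "\<bar>Y _\<bar>"] in simp)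
  also have "\<dots> = ennreal (s\<^sup>2) * (\<Sum>j. ennreal (2 * real j + 1) * (\<integral>\<^sup>+x. ?I j x \<partial>M))"
    by (simp add: nn_integral_cmult nn_integral_suminf)
  also have "\<dots> \<le> ennreal (s\<^sup>2) * (\<Sum>j. ennreal (2 * real j + 1) * ennreal (A * exp (- ((real j)\<^sup>2 / 2))))"
    by (intro mult_left_mono suminf_le level) auto
  also have "(\<lambda>j. ennreal (2 * real j + 1) * ennreal (A * exp (- ((real j)\<^sup>2 / 2)))) =
      (\<lambda>j. ennreal (A * ((2 * real j + 1) * exp (- ((real j)\<^sup>2 / 2)))))"
    using \<open>A \<ge> 1\<close> by (intro ext) (subst ennreal_mult[symmetric], auto simp: mult_ac)
  also have "(\<Sum>j. ennreal (A * ((2 * real j + 1) * exp (- ((real j)\<^sup>2 / 2))))) = ennreal (A * odd_gauss_sum)"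
    unfolding odd_gauss_sum_def
    by (rule suminf_ennreal_eq)
       (use \<open>A \<ge> 1\<close> summable_odd_gauss in \<open>auto intro!: sums_mult summable_sums\<close>)
  also have "ennreal (s\<^sup>2) * \<dots> = ennreal (A * odd_gauss_sum * s\<^sup>2)"
    using \<open>A \<ge> 1\<close> odd_gauss_sum_nonneg by (simp add: mult_ac flip: ennreal_mult)
  finally show ?thesis .
qed

section \<open>The upper bound\<close>

lemma eucl_dist_sq: "(eucl_dist d x y)\<^sup>2 = (\<Sum>i<d. (x i - y i)\<^sup>2)"
  by (simp add: eucl_dist_def L2_set_def sum_nonneg)

lemma eucl_dist_triangle: "eucl_dist d x z \<le> eucl_dist d x y + eucl_dist d y z"
  using L2_set_triangle_ineq[of "\<lambda>i. x i - y i" "\<lambda>i. y i - z i" "{..<d}"]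
  by (simp add: eucl_dist_def)

lemma component_measurable:
  "k \<le> m \<Longrightarrow> (\<lambda>x. x k) \<in> measurable (joint_space m d) (eucl_space d)"
  unfolding joint_space_def by (rule measurable_component_singleton) simp

lemma entry_measurable:
  "k \<le> m \<Longrightarrow> i < d \<Longrightarrow> (\<lambda>x. x k i) \<in> borel_measurable (joint_space m d)"
  using measurable_compose[OF component_measurable[of k m d],
      of "\<lambda>y. y i" borel] by (simp add: eucl_space_def)

lemma rate_attained:
  obtains S where "0 \<in> S" "S \<subseteq> {..m}"
    "rate m d h n \<tau> = real d * \<tau>\<^sup>2 / real (\<Sum>k\<in>S. n k) + (MAX k\<in>S. (h(0 := 0)) k)\<^sup>2"
proof -
  let ?A = "{S. {0} \<subseteq> S \<and> S \<subseteq> {..m}}"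
  have "finite ?A" by (rule finite_subset[of _ "Pow {..m}"]) auto
  moreover have "{0} \<in> ?A" by auto
  ultimately have "rate m d h n \<tau> \<in>
      (\<lambda>S. real d * \<tau>\<^sup>2 / real (\<Sum>k\<in>S. n k) + (MAX k\<in>S. (h(0 := 0)) k)\<^sup>2) ` ?A"
    unfolding rate_def by (intro Min_in) blast+
  with that show ?thesis by auto
qed

lemma rate_le:
  assumes "0 \<in> S" "S \<subseteq> {..m}"
  shows "rate m d h n \<tau> \<le> real d * \<tau>\<^sup>2 / real (\<Sum>k\<in>S. n k) + (MAX k\<in>S. (h(0 := 0)) k)\<^sup>2"
proof -
  have "finite {S. {0} \<subseteq> S \<and> S \<subseteq> {..m}}" by (rule finite_subset[of _ "Pow {..m}"]) auto
  thus ?thesis unfolding rate_def by (intro Min_le) (use assms in auto)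
qed

lemma directional_tail:
  assumes "prob_space P" and tb: "tail_bound m d C n \<tau> P \<theta>"
    and "k \<le> m" "t > 0" "L2_set a {..<d} = 1"
  shows "measure P {x \<in> space P. (\<Sum>i<d. a i * (x k i - \<theta> k i)) > t}
           \<le> C * exp (- (real (n k) * t\<^sup>2 / (2 * \<tau>\<^sup>2)))"
proof -
  interpret prob_space P by fact
  have "measure P {x \<in> space P. (\<Sum>i<d. a i * (x k i - \<theta> k i)) > t} \<le>
      (SUP a\<in>{a. L2_set a {..<d} = 1}.
           measure P {x \<in> space P. (\<Sum>i<d. a i * (x k i - \<theta> k i)) > t})"
    by (rule cSUP_upper) (use assms in \<open>auto intro!: bdd_aboveI[of _ 1]\<close>)
  also have "\<dots> \<le> C * exp (- (real (n k) * t\<^sup>2 / (2 * \<tau>\<^sup>2)))"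
    using tb assms unfolding tail_bound_def by auto
  finally show ?thesis .
qed

text \<open>
  The directions \<open>e\<^sub>i\<close> and \<open>- e\<^sub>i\<close> give the two one-sided tails of the \<open>i\<close>-th coordinate error.
\<close>

lemma coordinate_tail:
  assumes P: "prob_space P" and sets_P: "sets P = sets (joint_space m d)"
    and tb: "tail_bound m d C n \<tau> P \<theta>"
    and k: "k \<le> m" and i: "i < d" and t: "t > 0"
  shows "measure P {x \<in> space P. \<bar>x k i - \<theta> k i\<bar> > t}
           \<le> 2 * C * exp (- (real (n k) * t\<^sup>2 / (2 * \<tau>\<^sup>2)))"
proof -
  interpret prob_space P by fact
  have [measurable]: "(\<lambda>x. x k i) \<in> borel_measurable P"
    unfolding measurable_cong_sets[OF sets_P refl] by (rule entry_measurable[OF k i])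
  have unit: "L2_set (\<lambda>j. if j = i then \<sigma> else 0) {..<d} = 1" if "\<bar>\<sigma>\<bar> = 1" for \<sigma> :: real
  proof -
    have "(\<Sum>j<d. (if j = i then \<sigma> else 0)\<^sup>2) = (\<Sum>j<d. if j = i then \<sigma>\<^sup>2 else 0)"
      by (intro sum.cong) auto
    also have "\<dots> = \<sigma>\<^sup>2" using i by simp
    also have "sqrt \<dots> = 1" using that by simp
    finally show ?thesis by (simp add: L2_set_def)
  qed
  have pick: "(\<Sum>j<d. (if j = i then \<sigma> else 0) * (x k j - \<theta> k j)) = \<sigma> * (x k i - \<theta> k i)"
    for \<sigma> :: real and x :: "nat \<Rightarrow> nat \<Rightarrow> real"
  proof -
    have "(\<Sum>j<d. (if j = i then \<sigma> else 0) * (x k j - \<theta> k j)) =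
        (\<Sum>j<d. if j = i then \<sigma> * (x k i - \<theta> k i) else 0)"
      by (intro sum.cong) auto
    also have "\<dots> = \<sigma> * (x k i - \<theta> k i)" using i by simp
    finally show ?thesis .
  qed
  have split: "{x \<in> space P. \<bar>x k i - \<theta> k i\<bar> > t} =
      {x \<in> space P. 1 * (x k i - \<theta> k i) > t} \<union> {x \<in> space P. (-1) * (x k i - \<theta> k i) > t}"
    by auto
  have "measure P {x \<in> space P. \<bar>x k i - \<theta> k i\<bar> > t} \<le> measure P {x \<in> space P. 1 * (x k i - \<theta> k i) > t} +
      measure P {x \<in> space P. (-1) * (x k i - \<theta> k i) > t}"
    unfolding split by (rule measure_Un_le; measurable)
  also have "\<dots> \<le> C * exp (- (real (n k) * t\<^sup>2 / (2 * \<tau>\<^sup>2))) + C * exp (- (real (n k) * t\<^sup>2 / (2 * \<tau>\<^sup>2)))"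
  proof (rule add_mono)
    show "measure P {x \<in> space P. 1 * (x k i - \<theta> k i) > t} \<le> C * exp (- (real (n k) * t\<^sup>2 / (2 * \<tau>\<^sup>2)))"
      using directional_tail[OF P tb k t unit[of 1]] by (simp only: pick)
    show "measure P {x \<in> space P. (-1) * (x k i - \<theta> k i) > t} \<le> C * exp (- (real (n k) * t\<^sup>2 / (2 * \<tau>\<^sup>2)))"
      using directional_tail[OF P tb k t unit[of "-1"]] by (simp only: pick)
  qed
  finally show ?thesis by simp
qed

text \<open>
  The factor \<open>1 + 2 C\<close> is the two-sided tail constant \<open>2 C\<close>, enlarged so as to be at least \<open>1\<close>.  Each
  coordinate error has scale \<open>\<tau> / sqrt (n k)\<close>, and the \<open>d\<close> second moments add up by linearity.
\<close>

lemma local_estimator_risk: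
  assumes P: "prob_space P" and sets_P: "sets P = sets (joint_space m d)"
    and tb: "tail_bound m d C n \<tau> P \<theta>"
    and k: "k \<le> m" and n: "n k \<ge> 1" and \<tau>: "\<tau> > 0" and C: "C > 0"
  shows "(\<integral>\<^sup>+x. ennreal ((eucl_dist d (x k) (\<theta> k))\<^sup>2) \<partial>P)
           \<le> ennreal ((1 + 2 * C) * odd_gauss_sum * (real d * \<tau>\<^sup>2 / real (n k)))"
proof -
  interpret prob_space P by fact
  define s where "s = \<tau> / sqrt (real (n k))"
  have s: "s > 0" "s\<^sup>2 = \<tau>\<^sup>2 / real (n k)"
    using n \<tau> by (auto simp: s_def power_divide)
  have meas: "(\<lambda>x. x k i) \<in> borel_measurable P" if "i < d" for i
    unfolding measurable_cong_sets[OF sets_P refl] by (rule entry_measurable[OF k that])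
  have "(\<integral>\<^sup>+x. ennreal ((eucl_dist d (x k) (\<theta> k))\<^sup>2) \<partial>P) =
      (\<Sum>i<d. \<integral>\<^sup>+x. ennreal ((x k i - \<theta> k i)\<^sup>2) \<partial>P)"
    by (subst nn_integral_sum[symmetric])
       (auto simp: eucl_dist_sq intro!: measurable_compose[OF _ measurable_ennreal]
         borel_measurable_power borel_measurable_diff meas)
  also have "\<dots> \<le> (\<Sum>i<d. ennreal ((1 + 2 * C) * odd_gauss_sum * s\<^sup>2))"
  proof (intro sum_mono second_moment_le_of_subgaussian_tail)
    fix i t assume i: "i \<in> {..<d}" and t: "(t::real) > 0"
    have "prob {x \<in> space P. \<bar>x k i - \<theta> k i\<bar> > t} \<le> 2 * C * exp (- (t\<^sup>2 / (2 * s\<^sup>2)))"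
      using coordinate_tail[OF P sets_P tb k _ t, of i] i by (simp add: s(2) mult_ac)
    also have "\<dots> \<le> (1 + 2 * C) * exp (- (t\<^sup>2 / (2 * s\<^sup>2)))"
      by (intro mult_right_mono) auto
    finally show "prob {x \<in> space P. \<bar>x k i - \<theta> k i\<bar> > t} \<le> (1 + 2 * C) * exp (- (t\<^sup>2 / (2 * s\<^sup>2)))" .
  qed (use meas C s in auto)
  also have "\<dots> = ennreal ((1 + 2 * C) * odd_gauss_sum * (real d * \<tau>\<^sup>2 / real (n k)))"
    unfolding s(2) sum_constant card_lessThan ennreal_of_nat_eq_real_of_nat
    using C odd_gauss_sum_nonneg by (subst ennreal_mult[symmetric]) (auto simp: mult_ac)
  finally show ?thesis .
qed

text \<open>
  It is enough to use one local estimator, namely the one with the largest sample in an optimal set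
  \<open>S\<close>.  That sample makes up at least a fraction \<open>1 / (m + 1)\<close> of \<open>N\<^sub>S\<close>, so that its variance is of the
  order \<open>d \<tau>\<^sup>2 / N\<^sub>S\<close>, and its squared bias is at most \<open>h\<^sub>S\<^sup>2\<close>.  A weighted average over \<open>S\<close> could improve
  this only by a factor that depends on \<open>m\<close>.
\<close>

theorem minimax_risk_le_rate:
  assumes n: "\<forall>k\<in>{..m}. n k \<ge> 1"
    and \<tau>: "\<tau> > 0" and C: "C > 0"
  shows "minimax_risk m d C h n \<tau> \<le>
    ennreal ((2 * (1 + 2 * C) * odd_gauss_sum * (real m + 1) + 2) * rate m d h n \<tau>)"
proof -
  obtain S where S: "0 \<in> S" "S \<subseteq> {..m}"
    and rate: "rate m d h n \<tau> = real d * \<tau>\<^sup>2 / real (\<Sum>k\<in>S. n k) + (MAX k\<in>S. (h(0 := 0)) k)\<^sup>2"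
    by (rule rate_attained)
  define N where "N = (\<Sum>k\<in>S. n k)"
  define b where "b = (MAX k\<in>S. (h(0 := 0)) k)"
  define G where "G = (1 + 2 * C) * odd_gauss_sum"
  have G: "G \<ge> 0" using C odd_gauss_sum_nonneg by (simp add: G_def)
  have finS: "finite S" using S finite_subset by blast
  have "Max (n ` S) \<in> n ` S" using finS S(1) by (intro Max_in) auto
  then obtain k where k: "k \<in> S" "n k = Max (n ` S)" by auto
  have nmax: "n j \<le> n k" if "j \<in> S" for j using finS that by (simp add: k)
  have km: "k \<le> m" using k S by auto
  have nk: "n k \<ge> 1" using n km by auto
  have Npos: "N \<ge> 1"
    using k nk finS member_le_sum[of k S n] unfolding N_def by linarith
  have "N \<le> card S * n k" unfolding N_def using sum_bounded_above[of S n "n k"] nmax by auto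
  also have "\<dots> \<le> (m + 1) * n k" using card_mono[OF _ S(2)] by (intro mult_right_mono) auto
  finally have "real N \<le> (real m + 1) * real (n k)"
    by (metis of_nat_1 of_nat_add of_nat_le_iff of_nat_mult)
  hence var: "real d * \<tau>\<^sup>2 / real (n k) \<le> (real m + 1) * (real d * \<tau>\<^sup>2 / real N)"
    using nk Npos mult_left_mono[of "real N" "(real m + 1) * real (n k)" "real d * \<tau>\<^sup>2"] by (simp add: field_simps)
  have hk: "(h(0 := 0)) k \<le> b" unfolding b_def using finS k by (intro Max_ge) auto
  have "minimax_risk m d C h n \<tau> \<le> worst_risk m d C h n \<tau> (\<lambda>x. x k)"
    unfolding minimax_risk_def by (intro INF_lower component_measurable km)
  also have "\<dots> \<le> ennreal (2 * (G * ((real m + 1) * (real d * \<tau>\<^sup>2 / real N))) + 2 * b\<^sup>2)"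
    unfolding worst_risk_def
  proof (intro SUP_least)
    fix P \<theta> assume "P \<in> dist_class m d C h n \<tau>" and th: "\<theta> \<in> true_params m d C h n \<tau> P"
    hence P: "prob_space P" "sets P = sets (joint_space m d)" by (auto simp: dist_class_def)
    interpret prob_space P by fact
    have pc: "\<theta> \<in> param_class m d h" and tb: "tail_bound m d C n \<tau> P \<theta>"
      using th by (auto simp: true_params_def)
    have "eucl_dist d (\<theta> k) (\<theta> 0) \<le> (h(0 := 0)) k"
      using pc km by (cases "k = 0") (auto simp: param_class_def eucl_dist_def L2_set_def)
    hence bias: "eucl_dist d (\<theta> k) (\<theta> 0) \<le> b" using hk by simp
    have nonneg: "0 \<le> eucl_dist d x y" for x y by (simp add: eucl_dist_def)
    have meas: "(\<lambda>x. ennreal ((eucl_dist d (x k) (\<theta> k))\<^sup>2)) \<in> borel_measurable P"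
      unfolding eucl_dist_sq measurable_cong_sets[OF P(2) refl]
      by (intro measurable_compose[OF _ measurable_ennreal] borel_measurable_sum
         borel_measurable_power borel_measurable_diff entry_measurable km) auto
    have "ennreal ((eucl_dist d (x k) (\<theta> 0))\<^sup>2) \<le>
        2 * ennreal ((eucl_dist d (x k) (\<theta> k))\<^sup>2) + ennreal (2 * b\<^sup>2)" for x
    proof -
      have "(eucl_dist d (x k) (\<theta> 0))\<^sup>2 \<le> (eucl_dist d (x k) (\<theta> k) + b)\<^sup>2"
        using eucl_dist_triangle[of d "x k" "\<theta> 0" "\<theta> k"] bias nonneg by (intro power_mono) (auto intro: order_trans)
      also have "\<dots> \<le> 2 * (eucl_dist d (x k) (\<theta> k))\<^sup>2 + 2 * b\<^sup>2"
        using sum_squares_bound[of "eucl_dist d (x k) (\<theta> k)" b] by (simp add: power2_sum)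
      finally have "ennreal ((eucl_dist d (x k) (\<theta> 0))\<^sup>2) \<le>
          ennreal (2 * (eucl_dist d (x k) (\<theta> k))\<^sup>2 + 2 * b\<^sup>2)"
        by (rule ennreal_leI)
      also have "\<dots> = 2 * ennreal ((eucl_dist d (x k) (\<theta> k))\<^sup>2) + ennreal (2 * b\<^sup>2)"
        by (subst ennreal_plus, simp, simp, subst ennreal_mult) auto
      finally show ?thesis .
    qed
    hence "(\<integral>\<^sup>+x. ennreal ((eucl_dist d (x k) (\<theta> 0))\<^sup>2) \<partial>P) \<le>
       (\<integral>\<^sup>+x. 2 * ennreal ((eucl_dist d (x k) (\<theta> k))\<^sup>2) + ennreal (2 * b\<^sup>2) \<partial>P)"
      by (intro nn_integral_mono)
    also have "\<dots> = 2 * (\<integral>\<^sup>+x. ennreal ((eucl_dist d (x k) (\<theta> k))\<^sup>2) \<partial>P) + ennreal (2 * b\<^sup>2)"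
      using meas by (simp add: nn_integral_add nn_integral_cmult emeasure_space_1)
    also have "\<dots> \<le> 2 * ennreal (G * (real d * \<tau>\<^sup>2 / real (n k))) + ennreal (2 * b\<^sup>2)"
      using local_estimator_risk[OF P tb km nk \<tau> C] unfolding G_def by (intro add_mono mult_left_mono) auto
    also have "\<dots> = ennreal (2 * (G * (real d * \<tau>\<^sup>2 / real (n k))) + 2 * b\<^sup>2)"
      using G n km by (subst ennreal_plus, simp, simp, subst ennreal_mult) auto
    also have "\<dots> \<le> ennreal (2 * (G * ((real m + 1) * (real d * \<tau>\<^sup>2 / real N))) + 2 * b\<^sup>2)"
      using var G by (intro ennreal_leI add_mono mult_left_mono) auto
    finally show "(\<integral>\<^sup>+x. ennreal ((eucl_dist d (x k) (\<theta> 0))\<^sup>2) \<partial>P) \<le> \<dots>" .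
  qed
  also have "\<dots> \<le> ennreal ((2 * G * (real m + 1) + 2) * (real d * \<tau>\<^sup>2 / real N + b\<^sup>2))"
  proof (intro ennreal_leI)
    define v where "v = real d * \<tau>\<^sup>2 / real N"
    have "0 \<le> 2 * v + 2 * G * (real m + 1) * b\<^sup>2" using G by (simp add: v_def)
    thus "2 * (G * ((real m + 1) * (real d * \<tau>\<^sup>2 / real N))) + 2 * b\<^sup>2 \<le>
        (2 * G * (real m + 1) + 2) * (real d * \<tau>\<^sup>2 / real N + b\<^sup>2)"
      unfolding v_def[symmetric] by (simp add: algebra_simps)
  qed
  finally show ?thesis unfolding rate G_def N_def b_def by (simp only: mult.assoc)
qed

section \<open>A hard-to-identify local estimator\<close>

text \<open>
  A law on two points with mean \<open>v\<close> whose support does not change when \<open>v\<close> is replaced by \<open>- v\<close>.  One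
  observation therefore never reveals the sign of \<open>v\<close> with certainty: the likelihood ratio of the two
  signs is at most \<open>3\<close>.
\<close>

definition two_point :: "real \<Rightarrow> real pmf" where
  "two_point v = map_pmf (\<lambda>b. if b then 2 * v else - (2 * v)) (bernoulli_pmf (3/4))"

definition noisy_vec :: "nat \<Rightarrow> (nat \<Rightarrow> real) \<Rightarrow> (nat \<Rightarrow> real) pmf" where
  "noisy_vec d v = Pi_pmf {..<d} 0 (\<lambda>i. two_point (v i))"

text \<open>
  When the constant \<open>C\<close> of the tail condition is below \<open>1/2\<close>, the condition forces the error in every
  direction to vanish with positive probability.  The estimator therefore returns \<open>v\<close> itself with
  probability \<open>1 - p\<close>, which multiplies all tails by \<open>p\<close>.
\<close>

definition lazy_vec :: "real \<Rightarrow> nat \<Rightarrow> (nat \<Rightarrow> real) \<Rightarrow> (nat \<Rightarrow> real) pmf" where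
  "lazy_vec p d v = bernoulli_pmf p \<bind> (\<lambda>b. if b then noisy_vec d v else return_pmf v)"

lemma pmf_two_point:
  "pmf (two_point v) y = 3/4 * of_bool (y = 2 * v) + 1/4 * of_bool (y = - (2 * v))"
  unfolding two_point_def map_pmf_def by (auto simp: pmf_bind indicator_def)

lemma pmf_two_point_flip: "pmf (two_point v) y \<le> 3 * pmf (two_point (- v)) y"
  by (auto simp: pmf_two_point)

lemma expectation_two_point: "measure_pmf.expectation (two_point v) (\<lambda>y. y) = v"
  by (simp add: two_point_def)

lemma pmf_noisy_vec_flip:
  assumes "i < d"
  shows "pmf (noisy_vec d v) y \<le> 3 * pmf (noisy_vec d (v(i := - v i))) y"
proof -
  let ?w = "v(i := - v i)"
  have split: "(\<Prod>j<d. pmf (two_point (u j)) (y j)) =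
      pmf (two_point (u i)) (y i) * (\<Prod>j\<in>{..<d} - {i}. pmf (two_point (u j)) (y j))" for u :: "nat \<Rightarrow> real"
    using assms by (intro prod.remove) auto
  have "(\<Prod>j\<in>{..<d} - {i}. pmf (two_point (?w j)) (y j)) = (\<Prod>j\<in>{..<d} - {i}. pmf (two_point (v j)) (y j))"
    by (intro prod.cong) auto
  hence "(\<Prod>j<d. pmf (two_point (v j)) (y j)) \<le> 3 * (\<Prod>j<d. pmf (two_point (?w j)) (y j))"
    unfolding split using mult_right_mono[OF pmf_two_point_flip[of "v i" "y i"]]
    by (simp add: prod_nonneg mult.assoc)
  thus ?thesis by (auto simp: noisy_vec_def pmf_Pi intro: prod_nonneg)
qed

lemma pmf_lazy_vec_ge:
  assumes "0 \<le> p" "p \<le> 1"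
  shows "p * pmf (noisy_vec d v) y \<le> pmf (lazy_vec p d v) y"
  using assms by (simp add: lazy_vec_def pmf_bind mult.commute)

text \<open>
  In a unit direction \<open>a\<close> the error is a sum of independent centred variables with ranges
  \<open>4 \<delta> \<bar>a i\<bar>\<close>, whose squares add up to \<open>16 \<delta>\<^sup>2\<close> in every dimension.  Hoeffding's inequality thus gives a bound
  that does not depend on \<open>d\<close>.
\<close>

lemma noisy_vec_tail:
  assumes \<delta>: "\<delta> > 0" "\<And>i. i < d \<Longrightarrow> \<bar>v i\<bar> = \<delta>" and a: "L2_set a {..<d} = 1" and t: "t > 0"
  shows "measure_pmf.prob (noisy_vec d v) {y. (\<Sum>i<d. a i * (y i - v i)) > t}
           \<le> exp (- (t\<^sup>2 / (8 * \<delta>\<^sup>2)))"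
proof -
  let ?M = "noisy_vec d v"
  have a2: "(\<Sum>i<d. (a i)\<^sup>2) = 1" using a by (simp add: L2_set_def)
  have comp: "map_pmf (\<lambda>y. y i) ?M = two_point (v i)" if "i < d" for i
    using that by (simp add: noisy_vec_def Pi_pmf_component)
  have mean: "measure_pmf.expectation ?M (\<lambda>y. a i * y i) = a i * v i" if "i < d" for i
  proof -
    have "measure_pmf.expectation ?M (\<lambda>y. y i) = measure_pmf.expectation (map_pmf (\<lambda>y. y i) ?M) (\<lambda>z. z)"
      by (simp only: integral_map_pmf)
    also have "\<dots> = v i" by (simp only: comp[OF that] expectation_two_point)
    finally show ?thesis by simp
  qed
  interpret Hoeffding_ineq "measure_pmf ?M" "{..<d}" "\<lambda>i y. a i * y i"
    "\<lambda>i. - (2 * \<delta> * \<bar>a i\<bar>)" "\<lambda>i. 2 * \<delta> * \<bar>a i\<bar>" "\<Sum>i<d. measure_pmf.expectation ?M (\<lambda>y. a i * y i)"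
  proof unfold_locales
    show "prob_space.indep_vars ?M (\<lambda>_. borel) (\<lambda>i y. a i * y i) {..<d}"
      unfolding noisy_vec_def
      by (rule prob_space.indep_vars_compose2[OF measure_pmf.prob_space_axioms indep_vars_Pi_pmf]) auto
    fix i assume i: "i \<in> {..<d}"
    have "\<bar>y i\<bar> \<le> 2 * \<delta>" if "y \<in> set_pmf ?M" for y
    proof -
      have "y i \<in> set_pmf (two_point (v i))"
        using comp[of i] i that by (metis imageI lessThan_iff set_map_pmf)
      thus ?thesis using \<delta>(2)[of i] \<delta>(1) i by (auto simp: two_point_def split: if_splits)
    qed
    hence "\<bar>a i * y i\<bar> \<le> 2 * \<delta> * \<bar>a i\<bar>" if "y \<in> set_pmf ?M" for y
      using that by (simp add: abs_mult mult.commute mult_left_mono)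
    thus "AE y in measure_pmf ?M. a i * y i \<in> {- (2 * \<delta> * \<bar>a i\<bar>)..2 * \<delta> * \<bar>a i\<bar>}"
      by (force simp: AE_measure_pmf_iff abs_le_iff)
  qed simp_all
  have width: "(\<Sum>i<d. (2 * \<delta> * \<bar>a i\<bar> - - (2 * \<delta> * \<bar>a i\<bar>))\<^sup>2) = 16 * \<delta>\<^sup>2"
  proof -
    have "(\<Sum>i<d. (2 * \<delta> * \<bar>a i\<bar> - - (2 * \<delta> * \<bar>a i\<bar>))\<^sup>2) = (\<Sum>i<d. 16 * \<delta>\<^sup>2 * (a i)\<^sup>2)"
      by (intro sum.cong) (auto simp: power_mult_distrib)
    thus ?thesis using a2 by (simp flip: sum_distrib_left)
  qed
  have "measure_pmf.prob ?M {y. (\<Sum>i<d. a i * (y i - v i)) > t} \<le>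
      measure_pmf.prob ?M {y \<in> space ?M. (\<Sum>i<d. a i * y i) \<ge> (\<Sum>i<d. measure_pmf.expectation ?M (\<lambda>y. a i * y i)) + t}"
  proof (intro measure_pmf.finite_measure_mono)
    have "(\<Sum>i<d. measure_pmf.expectation ?M (\<lambda>y. a i * y i)) = (\<Sum>i<d. a i * v i)"
      by (intro sum.cong refl mean) simp
    thus "{y. (\<Sum>i<d. a i * (y i - v i)) > t} \<subseteq>
        {y \<in> space ?M. (\<Sum>i<d. a i * y i) \<ge> (\<Sum>i<d. measure_pmf.expectation ?M (\<lambda>y. a i * y i)) + t}"
      unfolding right_diff_distrib sum_subtractf by auto
  qed simp
  also have "\<dots> \<le> exp (- 2 * t\<^sup>2 / (16 * \<delta>\<^sup>2))"
    using Hoeffding_ineq_ge[of t] t \<delta> unfolding width by simp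
  finally show ?thesis by simp
qed

lemma lazy_vec_tail:
  assumes \<delta>: "\<delta> > 0" "\<And>i. i < d \<Longrightarrow> \<bar>v i\<bar> = \<delta>" and a: "L2_set a {..<d} = 1" and t: "t > 0"
    and p: "0 \<le> p" "p \<le> 1"
  shows "measure_pmf.prob (lazy_vec p d v) {y. (\<Sum>i<d. a i * (y i - v i)) > t}
           \<le> p * exp (- (t\<^sup>2 / (8 * \<delta>\<^sup>2)))"
proof -
  let ?A = "{y. (\<Sum>i<d. a i * (y i - v i)) > t}"
  have "emeasure (lazy_vec p d v) ?A = emeasure (noisy_vec d v) ?A * ennreal p"
    using p t by (simp add: lazy_vec_def)
  hence "measure_pmf.prob (lazy_vec p d v) ?A = p * measure_pmf.prob (noisy_vec d v) ?A"
    using p by (simp add: measure_pmf.emeasure_eq_measure mult.commute flip: ennreal_mult)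
  thus ?thesis using noisy_vec_tail[OF \<delta> a t] p by (simp add: mult_left_mono)
qed

section \<open>Joint laws\<close>

text \<open>
  The sources outside \<open>S\<close> have parameter \<open>0\<close> and report it without error, so that they carry no
  information about \<open>v\<close>.
\<close>

definition local_law :: "real \<Rightarrow> nat \<Rightarrow> nat set \<Rightarrow> (nat \<Rightarrow> real) \<Rightarrow> nat \<Rightarrow> (nat \<Rightarrow> real) pmf" where
  "local_law p d S v k = (if k \<in> S then lazy_vec p d v else return_pmf (\<lambda>_. 0))"

definition joint_pmf :: "real \<Rightarrow> nat \<Rightarrow> nat \<Rightarrow> nat set \<Rightarrow> (nat \<Rightarrow> real) \<Rightarrow> (nat \<Rightarrow> nat \<Rightarrow> real) pmf" where
  "joint_pmf p m d S v = Pi_pmf {..m} (\<lambda>_. 0) (local_law p d S v)"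

text \<open>
  The joint law conditioned on the event that all estimators in \<open>S\<close> are noisy; only on this event
  are the hypotheses hard to tell apart.
\<close>

definition noisy_pmf :: "nat \<Rightarrow> nat \<Rightarrow> nat set \<Rightarrow> (nat \<Rightarrow> real) \<Rightarrow> (nat \<Rightarrow> nat \<Rightarrow> real) pmf" where
  "noisy_pmf m d S v =
     Pi_pmf {..m} (\<lambda>_. 0) (\<lambda>k. if k \<in> S then noisy_vec d v else return_pmf (\<lambda>_. 0))"

text \<open>
  Product probability mass functions take an arbitrary default value off the index set, whereas the
  points of a product measure space are \<open>undefined\<close> there.  This map passes from one to the other.
\<close>

definition trim :: "nat \<Rightarrow> nat \<Rightarrow> (nat \<Rightarrow> nat \<Rightarrow> real) \<Rightarrow> nat \<Rightarrow> nat \<Rightarrow> real" where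
  "trim m d x = (\<lambda>k\<in>{..m}. \<lambda>i\<in>{..<d}. x k i)"

definition joint_law :: "real \<Rightarrow> nat \<Rightarrow> nat \<Rightarrow> nat set \<Rightarrow> (nat \<Rightarrow> real) \<Rightarrow> (nat \<Rightarrow> nat \<Rightarrow> real) measure" where
  "joint_law p m d S v = distr (joint_pmf p m d S v) (joint_space m d) (trim m d)"

lemma restrict_in_eucl_space: "restrict y {..<d} \<in> space (eucl_space d)"
  by (simp add: eucl_space_def space_PiM)

lemma trim_in_space: "trim m d x \<in> space (joint_space m d)"
  unfolding trim_def joint_space_def space_PiM by (auto intro: restrict_in_eucl_space)

lemma trim_measurable: "trim m d \<in> measurable (measure_pmf q) (joint_space m d)"
  using trim_in_space by (auto simp: measurable_def)

lemma prob_space_joint_law: "prob_space (joint_law p m d S v)"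
  unfolding joint_law_def by (intro measure_pmf.prob_space_distr trim_measurable)

lemma sets_joint_law: "sets (joint_law p m d S v) = sets (joint_space m d)"
  by (simp add: joint_law_def)

text \<open>
  Independence is a property of the joint law alone: both sides say that the law is the product of
  its marginals.
\<close>

lemma (in prob_space) indep_vars_coordinates_of_joint_law:
  assumes "I \<noteq> {}" and indep: "indep_vars N X I"
  shows "prob_space.indep_vars (distr M (PiM I N) (\<lambda>x. \<lambda>i\<in>I. X i x)) N (\<lambda>i x. x i) I"
proof -
  let ?X = "\<lambda>x. \<lambda>i\<in>I. X i x" and ?D = "distr M (PiM I N) (\<lambda>x. \<lambda>i\<in>I. X i x)"
  have rv: "X i \<in> measurable M (N i)" if "i \<in> I" for i
    using indep that by (auto simp: indep_vars_def)
  have rvX: "?X \<in> measurable M (PiM I N)" using rv by (rule measurable_restrict)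
  interpret D: prob_space ?D by (rule prob_space_distr) fact
  have "distr ?D (PiM I N) (\<lambda>x. \<lambda>i\<in>I. x i) = distr M (PiM I N) ((\<lambda>x. \<lambda>i\<in>I. x i) \<circ> ?X)"
    by (intro distr_distr rvX measurable_restrict measurable_component_singleton)
  also have "\<dots> = distr M (PiM I N) ?X"
    by (intro distr_cong) (auto simp: fun_eq_iff)
  also have "\<dots> = PiM I (\<lambda>i. distr M (N i) (X i))"
    using indep_vars_iff_distr_eq_PiM'[OF assms(1) rv] indep by simp
  also have "\<dots> = PiM I (\<lambda>i. distr ?D (N i) (\<lambda>x. x i))"
    by (intro PiM_cong refl, subst distr_distr)
       (auto intro!: distr_cong rvX measurable_component_singleton)
  finally show ?thesis
    by (subst D.indep_vars_iff_distr_eq_PiM'[OF assms(1)]) (auto intro: measurable_component_singleton)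
qed

lemma joint_law_indep:
  "prob_space.indep_vars (joint_law p m d S v) (\<lambda>_. eucl_space d) (\<lambda>k x. x k) {..m}"
proof -
  let ?q = "joint_pmf p m d S v"
  have "prob_space.indep_vars ?q (\<lambda>_. eucl_space d) (\<lambda>k x. restrict (x k) {..<d}) {..m}"
    unfolding joint_pmf_def
  proof (rule prob_space.indep_vars_compose2[OF measure_pmf.prob_space_axioms indep_vars_Pi_pmf])
    show "(\<lambda>y. restrict y {..<d}) \<in> measurable (count_space UNIV) (eucl_space d)" for k :: nat
      unfolding measurable_count_space_eq1 using restrict_in_eucl_space by blast
  qed simp
  from prob_space.indep_vars_coordinates_of_joint_law[OF measure_pmf.prob_space_axioms _ this] show ?thesis
    unfolding joint_law_def joint_space_def trim_def by auto
qed

lemma joint_law_component_prob: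
  assumes k: "k \<le> m"
  shows "measure (joint_law p m d S v) {x \<in> space (joint_law p m d S v). (\<Sum>i<d. a i * (x k i - u i)) > t}
       = measure_pmf.prob (local_law p d S v k) {y. (\<Sum>i<d. a i * (y i - u i)) > t}"
proof -
  let ?q = "joint_pmf p m d S v"
  have meas: "{x \<in> space (joint_space m d). (\<Sum>i<d. a i * (x k i - u i)) > t} \<in> sets (joint_space m d)"
  proof -
    have "(\<lambda>x. \<Sum>i<d. a i * (x k i - u i)) \<in> borel_measurable (joint_space m d)"
      by (intro borel_measurable_sum borel_measurable_times borel_measurable_diff
           borel_measurable_const entry_measurable k) auto
    thus ?thesis by (rule borel_measurable_less[OF borel_measurable_const])
  qed
  have pre: "trim m d -` {x \<in> space (joint_space m d). (\<Sum>i<d. a i * (x k i - u i)) > t} \<inter> space ?q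
      = (\<lambda>x. x k) -` {y. (\<Sum>i<d. a i * (y i - u i)) > t}"
    using k by (auto simp: trim_in_space) (auto simp: trim_def)
  have "measure (joint_law p m d S v) {x \<in> space (joint_law p m d S v). (\<Sum>i<d. a i * (x k i - u i)) > t}
      = measure_pmf.prob ?q ((\<lambda>x. x k) -` {y. (\<Sum>i<d. a i * (y i - u i)) > t})"
    unfolding joint_law_def space_distr measure_distr[OF trim_measurable meas] pre ..
  also have "\<dots> = measure_pmf.prob (map_pmf (\<lambda>x. x k) ?q) {y. (\<Sum>i<d. a i * (y i - u i)) > t}"
    by (simp only: measure_map_pmf)
  also have "map_pmf (\<lambda>x. x k) ?q = local_law p d S v k"
    using k by (simp add: joint_pmf_def Pi_pmf_component)
  finally show ?thesis .
qed

text \<open>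
  A flip of one sign changes the mass that an informative estimator gives to a point by a factor of
  at most \<open>3\<close>, and passing to the noisy part costs a factor \<open>p\<close>; this happens at most \<open>m + 1\<close> times.
\<close>

lemma joint_pmf_dominates:
  assumes p: "0 \<le> p" "p \<le> 1" and w: "w = v \<or> (\<exists>i<d. w = v(i := - v i))"
  shows "(p / 3) ^ (m + 1) * pmf (noisy_pmf m d S v) x \<le> pmf (joint_pmf p m d S w) x"
proof -
  have vec: "p / 3 * pmf (noisy_vec d v) y \<le> pmf (lazy_vec p d w) y" for y
  proof -
    have "pmf (noisy_vec d v) y \<le> 3 * pmf (noisy_vec d w) y"
      using w pmf_noisy_vec_flip by auto
    hence "p / 3 * pmf (noisy_vec d v) y \<le> p * pmf (noisy_vec d w) y"
      using mult_left_mono[OF _ p(1)] by fastforce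
    also have "\<dots> \<le> pmf (lazy_vec p d w) y" by (rule pmf_lazy_vec_ge[OF p])
    finally show ?thesis .
  qed
  have zero: "p / 3 * pmf (return_pmf z) y \<le> pmf (return_pmf z) y" for z y :: "nat \<Rightarrow> real"
    using p by (simp add: indicator_def)
  have "(p / 3) ^ (m + 1) * (\<Prod>k\<le>m. pmf (if k \<in> S then noisy_vec d v else return_pmf (\<lambda>_. 0)) (x k)) =
      (\<Prod>k\<le>m. p / 3 * pmf (if k \<in> S then noisy_vec d v else return_pmf (\<lambda>_. 0)) (x k))"
    by (simp only: prod.distrib prod_constant card_atMost Suc_eq_plus1)
  also have "\<dots> \<le> (\<Prod>k\<le>m. pmf (local_law p d S w k) (x k))"
    using vec zero p by (intro prod_mono) (auto simp: local_law_def)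
  finally show ?thesis
    by (auto simp: joint_pmf_def noisy_pmf_def pmf_Pi)
qed

lemma nn_integral_mono_pmf:
  assumes "c \<ge> 0" "\<And>x. c * pmf q x \<le> pmf r x"
  shows "ennreal c * (\<integral>\<^sup>+x. f x \<partial>q) \<le> (\<integral>\<^sup>+x. f x \<partial>r)"
proof -
  have "ennreal c * (\<integral>\<^sup>+x. f x \<partial>q) = (\<integral>\<^sup>+x. ennreal (c * pmf q x) * f x \<partial>count_space UNIV)"
    unfolding nn_integral_measure_pmf using assms(1)
    by (subst nn_integral_cmult[symmetric]) (auto simp: ennreal_mult mult.assoc)
  also have "\<dots> \<le> (\<integral>\<^sup>+x. ennreal (pmf r x) * f x \<partial>count_space UNIV)"
    using assms by (intro nn_integral_mono mult_right_mono ennreal_leI) auto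
  also have "\<dots> = (\<integral>\<^sup>+x. f x \<partial>r)" by (rule nn_integral_measure_pmf[symmetric])
  finally show ?thesis .
qed

section \<open>The lower bound\<close>

text \<open>
  Assouad's argument: averaging over the hypercube, the flip of coordinate \<open>i\<close> permutes the
  vertices, so the average of \<open>e i\<close> is half the average of the two errors across an edge, hence at least
  \<open>b / 2\<close>.  The \<open>d\<close> coordinates add up.
\<close>

lemma hypercube_average:
  fixes e :: "nat \<Rightarrow> (nat \<Rightarrow> real) \<Rightarrow> ennreal" and b W :: ennreal and d :: nat
  defines "E \<equiv> {..<d} \<rightarrow>\<^sub>E {-1, 1 :: real}"
  assumes total: "\<And>\<epsilon>. \<epsilon> \<in> E \<Longrightarrow> (\<Sum>i<d. e i \<epsilon>) \<le> W"
    and pair: "\<And>i \<epsilon>. i < d \<Longrightarrow> \<epsilon> \<in> E \<Longrightarrow> b \<le> e i \<epsilon> + e i (\<epsilon>(i := - \<epsilon> i))"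
  shows "of_nat d * b \<le> 2 * W"
proof -
  have fin: "finite E" unfolding E_def by (intro finite_PiE) auto
  have ne: "card E \<noteq> 0" using fin by (auto simp: E_def card_eq_0_iff PiE_eq_empty_iff)
  have flip: "(\<Sum>\<epsilon>\<in>E. e i (\<epsilon>(i := - \<epsilon> i))) = (\<Sum>\<epsilon>\<in>E. e i \<epsilon>)" if "i < d" for i
    by (rule sum.reindex_bij_witness[where i = "\<lambda>\<epsilon>. \<epsilon>(i := - \<epsilon> i)" and j = "\<lambda>\<epsilon>. \<epsilon>(i := - \<epsilon> i)"])
       (use that in \<open>auto simp: E_def PiE_iff extensional_def split: if_splits\<close>)
  have "of_nat (card E) * (of_nat d * b) = (\<Sum>i<d. \<Sum>\<epsilon>\<in>E. b)"
    by (simp add: mult_ac)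
  also have "\<dots> \<le> (\<Sum>i<d. \<Sum>\<epsilon>\<in>E. e i \<epsilon> + e i (\<epsilon>(i := - \<epsilon> i)))"
    by (intro sum_mono pair) auto
  also have "\<dots> = (\<Sum>i<d. 2 * (\<Sum>\<epsilon>\<in>E. e i \<epsilon>))"
    by (intro sum.cong refl) (simp add: sum.distrib flip mult_2)
  also have "\<dots> = 2 * (\<Sum>\<epsilon>\<in>E. \<Sum>i<d. e i \<epsilon>)"
    by (subst sum.swap) (simp add: sum_distrib_left)
  also have "\<dots> \<le> 2 * (\<Sum>\<epsilon>\<in>E. W)"
    by (intro mult_left_mono sum_mono total) auto
  also have "\<dots> = of_nat (card E) * (2 * W)" by (simp add: mult_ac)
  finally show ?thesis using ne by (subst (asm) ennreal_mult_le_mult_iff) auto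
qed

text \<open>
  Two conditions make the construction admissible: the noise of size \<open>\<delta>\<close> must be within the tail bound
  of every estimator in \<open>S\<close>, and the target \<open>v\<close>, of squared norm \<open>d \<delta>\<^sup>2\<close>, must be within \<open>h k\<close> of the
  parameter \<open>0\<close> of every other source.
\<close>

lemma joint_law_in_class:
  assumes d: "d \<ge> 1" and p: "0 \<le> p" "p \<le> 1" "p \<le> C"
    and \<tau>: "\<tau> > 0" and n: "\<forall>k\<in>{..m}. n k \<ge> 1" and h: "\<forall>k\<in>{1..m}. h k \<ge> 0"
    and \<delta>: "\<delta> > 0" "\<And>i. i < d \<Longrightarrow> \<bar>v i\<bar> = \<delta>"
    and S0: "0 \<in> S"
    and small: "\<And>k. k \<in> S \<Longrightarrow> k \<le> m \<Longrightarrow> \<delta>\<^sup>2 \<le> \<tau>\<^sup>2 / (4 * real (n k))"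
    and far: "\<And>k. k \<notin> S \<Longrightarrow> k \<le> m \<Longrightarrow> real d * \<delta>\<^sup>2 \<le> (h k)\<^sup>2"
  defines "\<theta> \<equiv> trim m d (\<lambda>k. if k \<in> S then v else (\<lambda>_. 0))"
  shows "joint_law p m d S v \<in> dist_class m d C h n \<tau>"
    and "\<theta> \<in> true_params m d C h n \<tau> (joint_law p m d S v)"
proof -
  let ?P = "joint_law p m d S v"
  have C: "C \<ge> 0" using p by simp
  have \<theta>: "\<theta> k i = (if k \<in> S then v i else 0)" if "k \<le> m" "i < d" for k i
    using that by (simp add: \<theta>_def trim_def)
  have dist: "eucl_dist d (\<theta> k) (\<theta> 0) \<le> h k" if k: "k \<in> {1..m}" for k
  proof (cases "k \<in> S")
    case True
    hence "(eucl_dist d (\<theta> k) (\<theta> 0))\<^sup>2 = 0"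
      using S0 k by (auto simp: eucl_dist_sq \<theta>)
    thus ?thesis using h k by auto
  next
    case False
    have "(eucl_dist d (\<theta> k) (\<theta> 0))\<^sup>2 = (\<Sum>i<d. \<bar>v i\<bar>\<^sup>2)"
      using S0 False k by (auto simp: eucl_dist_sq \<theta>)
    also have "\<dots> = real d * \<delta>\<^sup>2" using \<delta>(2) by simp
    also have "\<dots> \<le> (h k)\<^sup>2" using far False k by auto
    finally show ?thesis using h k by (auto intro: power2_le_imp_le[of "eucl_dist d (\<theta> k) (\<theta> 0)" "h k"])
  qed
  have pc: "\<theta> \<in> param_class m d h"
    using dist trim_in_space by (auto simp: param_class_def \<theta>_def)
  have dir: "measure ?P {x \<in> space ?P. (\<Sum>i<d. a i * (x k i - \<theta> k i)) > t}
      \<le> C * exp (- (real (n k) * t\<^sup>2 / (2 * \<tau>\<^sup>2)))"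
    if k: "k \<le> m" and t: "t > 0" and a: "L2_set a {..<d} = 1" for k t a
  proof -
    let ?u = "if k \<in> S then v else (\<lambda>_. 0)"
    have sums: "(\<Sum>i<d. a i * (x k i - \<theta> k i)) = (\<Sum>i<d. a i * (x k i - ?u i))" for x :: "nat \<Rightarrow> nat \<Rightarrow> real"
      using k by (intro sum.cong) (auto simp: \<theta>)
    have "measure_pmf.prob (local_law p d S v k) {y. (\<Sum>i<d. a i * (y i - ?u i)) > t}
        \<le> C * exp (- (real (n k) * t\<^sup>2 / (2 * \<tau>\<^sup>2)))"
    proof (cases "k \<in> S")
      case True
      have nk: "real (n k) > 0" using n k by force
      have "measure_pmf.prob (lazy_vec p d v) {y. (\<Sum>i<d. a i * (y i - v i)) > t}
          \<le> p * exp (- (t\<^sup>2 / (8 * \<delta>\<^sup>2)))"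
        by (rule lazy_vec_tail[OF \<delta> a t p(1,2)])
      also have "\<dots> \<le> C * exp (- (real (n k) * t\<^sup>2 / (2 * \<tau>\<^sup>2)))"
      proof (intro mult_mono)
        have "8 * \<delta>\<^sup>2 * real (n k) \<le> 2 * \<tau>\<^sup>2"
          using small[OF True k] nk by (simp add: field_simps)
        hence "t\<^sup>2 * (8 * \<delta>\<^sup>2 * real (n k)) \<le> t\<^sup>2 * (2 * \<tau>\<^sup>2)" by (intro mult_left_mono) auto
        hence "real (n k) * t\<^sup>2 / (2 * \<tau>\<^sup>2) \<le> t\<^sup>2 / (8 * \<delta>\<^sup>2)"
          using \<tau> \<delta>(1) by (simp add: frac_le_eq divide_simps mult_ac)
        thus "exp (- (t\<^sup>2 / (8 * \<delta>\<^sup>2))) \<le> exp (- (real (n k) * t\<^sup>2 / (2 * \<tau>\<^sup>2)))" by simp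
      qed (use p C in auto)
      finally show ?thesis using True by (simp add: local_law_def)
    next
      case False
      thus ?thesis using t C by (simp add: local_law_def)
    qed
    thus ?thesis unfolding sums joint_law_component_prob[OF k] .
  qed
  have "\<exists>a. L2_set a {..<d} = (1 :: real)"
  proof
    have "(\<Sum>i<d. (if i = 0 then 1 else 0 :: real)\<^sup>2) = (\<Sum>i<d. if i = 0 then 1 else 0)"
      by (intro sum.cong) auto
    thus "L2_set (\<lambda>i. if i = 0 then 1 else 0) {..<d} = (1 :: real)"
      using d by (simp add: L2_set_def)
  qed
  hence "tail_bound m d C n \<tau> ?P \<theta>"
    unfolding tail_bound_def by (intro ballI allI impI cSUP_least) (use dir in auto)
  with pc show *: "\<theta> \<in> true_params m d C h n \<tau> ?P" by (simp add: true_params_def)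
  show "?P \<in> dist_class m d C h n \<tau>"
    unfolding dist_class_def using * prob_space_joint_law sets_joint_law joint_law_indep by blast
qed

text \<open>
  Both joint laws dominate \<open>(p / 3) ^ (m + 1)\<close> times the same noisy law, and under one law no value
  of \<open>g\<close> is close to both \<open>v i\<close> and \<open>- v i\<close>.
\<close>

lemma two_hypotheses_error:
  fixes g :: "(nat \<Rightarrow> nat \<Rightarrow> real) \<Rightarrow> real"
  assumes p: "0 \<le> p" "p \<le> 1" and i: "i < d" and s: "\<bar>v i\<bar> = \<delta>"
  shows "ennreal (2 * (p / 3) ^ (m + 1) * \<delta>\<^sup>2) \<le>
     (\<integral>\<^sup>+x. ennreal ((g x - v i)\<^sup>2) \<partial>joint_pmf p m d S v) +
     (\<integral>\<^sup>+x. ennreal ((g x + v i)\<^sup>2) \<partial>joint_pmf p m d S (v(i := - v i)))"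
proof -
  let ?c = "(p / 3) ^ (m + 1)" and ?q = "noisy_pmf m d S v"
  have c: "?c \<ge> 0" using p by simp
  have pt: "2 * \<delta>\<^sup>2 \<le> (z - v i)\<^sup>2 + (z + v i)\<^sup>2" for z
    unfolding s[symmetric] by (simp add: power2_eq_square algebra_simps)
  have "ennreal (2 * ?c * \<delta>\<^sup>2) = ennreal ?c * (\<integral>\<^sup>+x. ennreal (2 * \<delta>\<^sup>2) \<partial>?q)"
    using c by (simp add: measure_pmf.emeasure_space_1 mult_ac flip: ennreal_mult)
  also have "\<dots> \<le> ennreal ?c * (\<integral>\<^sup>+x. ennreal ((g x - v i)\<^sup>2) + ennreal ((g x + v i)\<^sup>2) \<partial>?q)"
    by (intro mult_left_mono nn_integral_mono, subst ennreal_plus[symmetric], simp, simp)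
       (intro ennreal_leI pt, simp)
  also have "\<dots> = ennreal ?c * (\<integral>\<^sup>+x. ennreal ((g x - v i)\<^sup>2) \<partial>?q) +
      ennreal ?c * (\<integral>\<^sup>+x. ennreal ((g x + v i)\<^sup>2) \<partial>?q)"
    by (simp add: nn_integral_add distrib_left)
  also have "\<dots> \<le> (\<integral>\<^sup>+x. ennreal ((g x - v i)\<^sup>2) \<partial>joint_pmf p m d S v) +
     (\<integral>\<^sup>+x. ennreal ((g x + v i)\<^sup>2) \<partial>joint_pmf p m d S (v(i := - v i)))"
    using i by (intro add_mono nn_integral_mono_pmf c joint_pmf_dominates p) auto
  finally show ?thesis .
qed

text \<open>
  The hypercube consists of the targets \<open>\<delta> \<epsilon>\<close> with \<open>\<epsilon> \<in> {-1, 1}\<^sup>d\<close>, and \<open>e i \<epsilon>\<close> is the risk in coordinate \<open>i\<close>.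
\<close>

lemma worst_risk_lower:
  assumes d: "d \<ge> 1" and p: "0 \<le> p" "p \<le> 1" "p \<le> C"
    and \<tau>: "\<tau> > 0" and n: "\<forall>k\<in>{..m}. n k \<ge> 1" and h: "\<forall>k\<in>{1..m}. h k \<ge> 0"
    and \<delta>: "\<delta> > 0" and S0: "0 \<in> S"
    and small: "\<And>k. k \<in> S \<Longrightarrow> k \<le> m \<Longrightarrow> \<delta>\<^sup>2 \<le> \<tau>\<^sup>2 / (4 * real (n k))"
    and far: "\<And>k. k \<notin> S \<Longrightarrow> k \<le> m \<Longrightarrow> real d * \<delta>\<^sup>2 \<le> (h k)\<^sup>2"
    and est: "est \<in> measurable (joint_space m d) (eucl_space d)"
  shows "ennreal ((p / 3) ^ (m + 1) * (real d * \<delta>\<^sup>2)) \<le> worst_risk m d C h n \<tau> est"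
proof -
  define e where "e i \<epsilon> = (\<integral>\<^sup>+x. ennreal ((est (trim m d x) i - \<delta> * \<epsilon> i)\<^sup>2)
      \<partial>joint_pmf p m d S (\<lambda>i. \<delta> * \<epsilon> i))" for i and \<epsilon> :: "nat \<Rightarrow> real"
  let ?W = "worst_risk m d C h n \<tau> est"
  have "of_nat d * ennreal (2 * (p / 3) ^ (m + 1) * \<delta>\<^sup>2) \<le> 2 * ?W"
  proof (rule hypercube_average[where e = e])
    fix \<epsilon> assume E: "\<epsilon> \<in> {..<d} \<rightarrow>\<^sub>E {-1, 1 :: real}"
    have \<epsilon>: "\<bar>\<epsilon> i\<bar> = 1" if "i < d" for i
    proof -
      have "\<epsilon> i \<in> {-1, 1}" using PiE_mem[OF E, of i] that by simp
      thus ?thesis by auto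
    qed
    let ?v = "\<lambda>i. \<delta> * \<epsilon> i"
    let ?P = "joint_law p m d S ?v" and ?\<theta> = "trim m d (\<lambda>k. if k \<in> S then ?v else (\<lambda>_. 0))"
    have v: "\<bar>?v i\<bar> = \<delta>" if "i < d" for i using \<epsilon>[OF that] \<delta> by (simp add: abs_mult)
    note cls = joint_law_in_class[OF d p \<tau> n h \<delta> v S0 small far]
    have meas: "(\<lambda>x. ennreal ((est x i - ?\<theta> 0 i)\<^sup>2)) \<in> borel_measurable (joint_space m d)" if "i < d" for i
    proof -
      have "(\<lambda>y. y i) \<in> borel_measurable (eucl_space d)"
        unfolding eucl_space_def by (rule measurable_component_singleton) (use that in simp)
      from measurable_compose[OF est this] show ?thesis by measurable
    qed
    have "(\<Sum>i<d. e i \<epsilon>) = (\<Sum>i<d. \<integral>\<^sup>+x. ennreal ((est (trim m d x) i - ?\<theta> 0 i)\<^sup>2) \<partial>joint_pmf p m d S ?v)"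
      unfolding e_def using S0 by (intro sum.cong refl nn_integral_cong) (auto simp: trim_def)
    also have "\<dots> = (\<Sum>i<d. \<integral>\<^sup>+x. ennreal ((est x i - ?\<theta> 0 i)\<^sup>2) \<partial>?P)"
      unfolding joint_law_def
      by (intro sum.cong refl nn_integral_distr[symmetric] trim_measurable) (use meas in auto)
    also have "\<dots> = (\<integral>\<^sup>+x. (\<Sum>i<d. ennreal ((est x i - ?\<theta> 0 i)\<^sup>2)) \<partial>?P)"
      by (rule nn_integral_sum[symmetric])
         (use meas in \<open>auto simp: measurable_cong_sets[OF sets_joint_law refl]\<close>)
    also have "\<dots> = (\<integral>\<^sup>+x. ennreal ((eucl_dist d (est x) (?\<theta> 0))\<^sup>2) \<partial>?P)"
      by (simp add: eucl_dist_sq)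
    also have "\<dots> \<le> (SUP \<theta>\<in>true_params m d C h n \<tau> ?P.
        \<integral>\<^sup>+x. ennreal ((eucl_dist d (est x) (\<theta> 0))\<^sup>2) \<partial>?P)"
      by (rule SUP_upper[OF cls(2)])
    also have "\<dots> \<le> ?W"
      unfolding worst_risk_def by (rule SUP_upper[OF cls(1)])
    finally show "(\<Sum>i<d. e i \<epsilon>) \<le> ?W" .
    fix i assume i: "i < d"
    have "(\<lambda>j. \<delta> * (\<epsilon>(i := - \<epsilon> i)) j) = ?v(i := - ?v i)" by (auto simp: fun_eq_iff)
    with two_hypotheses_error[where v = ?v and g = "\<lambda>x. est (trim m d x) i" and m = m and S = S, OF p(1,2) i v[OF i]]
    show "ennreal (2 * (p / 3) ^ (m + 1) * \<delta>\<^sup>2) \<le> e i \<epsilon> + e i (\<epsilon>(i := - \<epsilon> i))"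
      by (simp add: e_def)
  qed
  also have "of_nat d * ennreal (2 * (p / 3) ^ (m + 1) * \<delta>\<^sup>2) =
      2 * ennreal ((p / 3) ^ (m + 1) * (real d * \<delta>\<^sup>2))"
  proof -
    have "of_nat d * ennreal (2 * (p / 3) ^ (m + 1) * \<delta>\<^sup>2) = ennreal (real d * (2 * (p / 3) ^ (m + 1) * \<delta>\<^sup>2))"
      using p by (subst ennreal_mult) (auto simp: ennreal_of_nat_eq_real_of_nat)
    also have "real d * (2 * (p / 3) ^ (m + 1) * \<delta>\<^sup>2) = 2 * ((p / 3) ^ (m + 1) * (real d * \<delta>\<^sup>2))" by simp
    also have "ennreal \<dots> = 2 * ennreal ((p / 3) ^ (m + 1) * (real d * \<delta>\<^sup>2))"
      using p by (subst ennreal_mult) auto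
    finally show ?thesis .
  qed
  finally show ?thesis by (subst (asm) ennreal_mult_le_mult_iff) auto
qed

text \<open>
  With \<open>R\<close> the rate, the informative domains are those with \<open>h\<^sub>k\<^sup>2 \<le> R / 2\<close>.  By the minimality of
  \<open>R\<close>, this set \<open>S\<close> satisfies \<open>R \<le> d \<tau>\<^sup>2 / N\<^sub>S + h\<^sub>S\<^sup>2 \<le> d \<tau>\<^sup>2 / N\<^sub>S + R / 2\<close>, so its variance term is at least
  \<open>R / 2\<close>.  This leaves room for a hypercube of squared radius \<open>d \<delta>\<^sup>2 = R / 8\<close> in both admissibility
  conditions.
\<close>

theorem rate_le_minimax_risk:
  assumes d: "d \<ge> 1" and h: "\<forall>k\<in>{1..m}. h k \<ge> 0" and n: "\<forall>k\<in>{..m}. n k \<ge> 1"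
    and \<tau>: "\<tau> > 0" and C: "C > 0"
  shows "ennreal ((min 1 C / 3) ^ (m + 1) / 8 * rate m d h n \<tau>) \<le> minimax_risk m d C h n \<tau>"
proof -
  define R where "R = rate m d h n \<tau>"
  define S where "S = {k. k \<le> m \<and> ((h(0 := 0)) k)\<^sup>2 \<le> R / 2}"
  define N where "N = (\<Sum>k\<in>S. n k)"
  define b where "b = (MAX k\<in>S. (h(0 := 0)) k)"
  have Rpos: "R > 0"
  proof -
    obtain T where T: "0 \<in> T" "T \<subseteq> {..m}"
      and R: "R = real d * \<tau>\<^sup>2 / real (\<Sum>k\<in>T. n k) + (MAX k\<in>T. (h(0 := 0)) k)\<^sup>2"
      unfolding R_def by (rule rate_attained)
    have "finite T" using T finite_subset by blast
    hence "n 0 \<le> (\<Sum>k\<in>T. n k)" using T by (intro member_le_sum) auto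
    hence "(\<Sum>k\<in>T. n k) > 0" using n by force
    hence "real (\<Sum>k\<in>T. n k) > 0" by (simp only: of_nat_0_less_iff)
    hence "real d * \<tau>\<^sup>2 / real (\<Sum>k\<in>T. n k) > 0"
      using d \<tau> by (intro divide_pos_pos) (auto simp del: of_nat_sum)
    thus ?thesis unfolding R by (simp add: add_pos_nonneg)
  qed
  have S: "0 \<in> S" "S \<subseteq> {..m}" using Rpos by (auto simp: S_def)
  have finS: "finite S" using S finite_subset by blast
  have "b \<in> (h(0 := 0)) ` S" unfolding b_def using S finS by (intro Max_in) auto
  hence "b\<^sup>2 \<le> R / 2" by (auto simp: S_def)
  moreover have "R \<le> real d * \<tau>\<^sup>2 / real N + b\<^sup>2"
    unfolding R_def N_def b_def by (rule rate_le[OF S])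
  ultimately have var: "R / 2 \<le> real d * \<tau>\<^sup>2 / real N" by linarith
  \<comment> \<open>The tail condition asks for \<open>\<delta>\<^sup>2 \<le> \<tau>\<^sup>2 / (4 n k)\<close>; the factor 4 together with \<open>R / 2\<close> yields the 8.\<close>
  define \<delta> where "\<delta> = sqrt (R / (8 * real d))"
  have \<delta>: "\<delta> > 0" "\<delta>\<^sup>2 = R / (8 * real d)" "real d * \<delta>\<^sup>2 = R / 8"
    using Rpos d by (auto simp: \<delta>_def)
  have small: "\<delta>\<^sup>2 \<le> \<tau>\<^sup>2 / (4 * real (n k))" if k: "k \<in> S" "k \<le> m" for k
  proof -
    have nk: "real (n k) > 0" using n k by force
    have "n k \<le> N" unfolding N_def using k finS by (intro member_le_sum) auto
    hence "real d * \<tau>\<^sup>2 / real N \<le> real d * \<tau>\<^sup>2 / real (n k)"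
      using nk by (intro divide_left_mono mult_pos_pos) auto
    with var have "R / 2 \<le> real d * \<tau>\<^sup>2 / real (n k)" by (rule order_trans)
    thus ?thesis unfolding \<delta>(2) using nk d by (simp add: field_simps)
  qed
  have far: "real d * \<delta>\<^sup>2 \<le> (h k)\<^sup>2" if "k \<notin> S" "k \<le> m" for k
    using that S(1) Rpos unfolding \<delta>(3) by (cases "k = 0") (auto simp: S_def)
  show ?thesis unfolding minimax_risk_def
  proof (intro INF_greatest)
    fix est assume est: "est \<in> measurable (joint_space m d) (eucl_space d)"
    have "ennreal ((min 1 C / 3) ^ (m + 1) * (real d * \<delta>\<^sup>2)) \<le> worst_risk m d C h n \<tau> est"
      by (rule worst_risk_lower[OF d _ _ _ \<tau> n h \<delta>(1) S(1) small far est]) (use C in auto)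
    thus "ennreal ((min 1 C / 3) ^ (m + 1) / 8 * rate m d h n \<tau>) \<le> worst_risk m d C h n \<tau> est"
      unfolding \<delta>(3) R_def by simp
  qed
qed

theorem theorem2:
  fixes m :: nat and C\<^sub>\<tau> :: real
  assumes "C\<^sub>\<tau> > 0"
  shows "\<exists>c C :: real. 0 < c \<and> c \<le> C \<and>
    (\<forall>(d :: nat) (h :: nat \<Rightarrow> real) (n :: nat \<Rightarrow> nat) (\<tau> :: real).
       d \<ge> 1 \<longrightarrow> (\<forall>k\<in>{1..m}. h k \<in> {0..1}) \<longrightarrow> (\<forall>k\<in>{..m}. n k \<ge> 1) \<longrightarrow>
       \<tau> > 0 \<longrightarrow> real d * \<tau>\<^sup>2 / real (n 0) \<le> 1 \<longrightarrow>
       ennreal (c * rate m d h n \<tau>) \<le> minimax_risk m d C\<^sub>\<tau> h n \<tau> \<and>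
       minimax_risk m d C\<^sub>\<tau> h n \<tau> \<le> ennreal (C * rate m d h n \<tau>))"
proof (intro exI conjI allI impI)
  let ?c = "(min 1 C\<^sub>\<tau> / 3) ^ (m + 1) / 8"
  let ?C = "2 * (1 + 2 * C\<^sub>\<tau>) * odd_gauss_sum * (real m + 1) + 2"
  show "0 < ?c" using assms by simp
  have "(min 1 C\<^sub>\<tau> / 3) ^ (m + 1) \<le> 1" using assms by (intro power_le_one) auto
  moreover have "0 \<le> 2 * (1 + 2 * C\<^sub>\<tau>) * odd_gauss_sum * (real m + 1)"
    using assms odd_gauss_sum_nonneg by simp
  ultimately show "?c \<le> ?C" by linarith
  fix d :: nat and h :: "nat \<Rightarrow> real" and n :: "nat \<Rightarrow> nat" and \<tau> :: real
  assume "d \<ge> 1" "\<forall>k\<in>{1..m}. h k \<in> {0..1}" "\<forall>k\<in>{..m}. n k \<ge> 1" "\<tau> > 0"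
  with assms show "ennreal (?c * rate m d h n \<tau>) \<le> minimax_risk m d C\<^sub>\<tau> h n \<tau>"
    and "minimax_risk m d C\<^sub>\<tau> h n \<tau> \<le> ennreal (?C * rate m d h n \<tau>)"
    by (intro rate_le_minimax_risk minimax_risk_le_rate; simp)+
qed

end
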